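(* Let $\kappa$ be a field, $G$ a group and $\sigma\in pm(G)$ a factor set. Then $\mathcal{S}^\sigma(G)$, with the product $\star$ and the action of $\kappa$ described in the context, is a $\kappa$-cancellative inverse monoid.
   Context: A partial projective $\sigma$-representation of $G$ in a unital $\kappa$-algebra $R$ (with $1_R\neq 0$) is a map $\Gamma:G\to R$ for which there is a function $\sigma:G\times G\to\kappa$ (called the factor set) such that for all $g,h\in G$: (i) if $\sigma(g,h)=0$ then $\Gamma(g^{-1})\Gamma(gh)=0$ and $\Gamma(gh)\Gamma(h^{-1})=0$; (ii) if $\Gamma(g)\Gamma(h)=0$ then $\sigma(g,h)=0$; (iii) $\Gamma(1_G)=1_R$; (iv) $\Gamma(g^{-1})\Gamma(g)\Gamma(h)=\sigma(g,h)\Gamma(g^{-1})\Gamma(gh)$; (v) $\Gamma(g)\Gamma(h)\Gamma(h^{-1})=\sigma(g,h)\Gamma(gh)\Gamma(h^{-1})$. The set of all factor sets of $G$ (over all such $R$ and $\Gamma$) is $pm(G)$. Let $\Omega=\{\xi\subseteq G:1\in\xi\}$. The $\sigma$-prohibitions of type I are the sets $\{h,hg,hgs\}$ with $h,g,s\in G$ and $\sigma(g,s)=0$; those of type II are the sets $\{h,hg,hgs,hgst\}$ with $h,g,s,t\in G$ and $\sigma(g,st)\sigma(s,t)\neq\sigma(g,s)\sigma(gs,t)$. $\mathcal{P}_\sigma$ is the set of all $\sigma$-prohibitions (of both types), and $\Omega_\sigma=\{\xi\in\Omega: V\nsubseteq\xi \text{ for all } V\in\mathcal{P}_\sigma\}$.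 For $U\in\Omega$ put $\chi(U)=1$ if $U\in\Omega_\sigma$ and $\chi(U)=0$ otherwise. $\mathcal{S}^\sigma(G):=\{(k,U,g)\in\kappa\times\Omega_\sigma\times G: g\in U,\ k\neq0,\ |U|<\infty\}\cup\{0\}$. Write $k(U,g)$ for $(k,U,g)$ and $(U,g)$ for $1(U,g)$; by convention $0(U,g)=0$ for every $U\in\Omega$, $g\in U$. The field $\kappa$ acts by $r\cdot0=0$, $r\cdot k(U,g)=(rk)(U,g)$ for $r\neq0$, and $0\cdot k(U,g)=0$. The product is $k(U,g)\star r(V,h):=\sigma(g,h)\,\chi(U\cup gV)\,kr\,(U\cup gV,gh)$, and $0\star z=z\star0=0$. A $\kappa$-semigroup is a semigroup $T$ with zero $0_T$ and a map $\kappa\times T\to T$ with $r(tx)=(rt)x$, $r(xy)=(rx)y=x(ry)$, $1_\kappa x=x$, $0_\kappa x=0_T$ for all $r,t\in\kappa$, $x,y\in T$. It is $\kappa$-cancellative if moreover $rx=tx$ with $x\neq0_T$ implies $r=t$. An inverse monoid is a monoid in which every element $s$ has a unique $s^*$ with $ss^*s=s$ and $s^*ss^*=s^*$; a $\kappa$-cancellative inverse monoid is a $\kappa$-cancellative $\kappa$-semigroup which is also an inverse monoid. *)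

theory Defs
  imports "HOL-Algebra.Module" "HOL-Algebra.Coset"
begin

section \<open>Partial projective representations and factor sets\<close>

text \<open>The locale \<open>algebra\<close> of HOL-Algebra only covers commutative algebras.\<close>

locale nontrivial_unital_algebra = K?: field K + module K R + R?: ring R
  for K (structure) and R (structure) +
  assumes smult_mult_left:
      "\<lbrakk>a \<in> carrier K; x \<in> carrier R; y \<in> carrier R\<rbrakk> \<Longrightarrow>
        (a \<odot>\<^bsub>R\<^esub> x) \<otimes>\<^bsub>R\<^esub> y = a \<odot>\<^bsub>R\<^esub> (x \<otimes>\<^bsub>R\<^esub> y)"
    and smult_mult_right:
      "\<lbrakk>a \<in> carrier K; x \<in> carrier R; y \<in> carrier R\<rbrakk> \<Longrightarrow>
        x \<otimes>\<^bsub>R\<^esub> (a \<odot>\<^bsub>R\<^esub> y) = a \<odot>\<^bsub>R\<^esub> (x \<otimes>\<^bsub>R\<^esub> y)"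
    and one_neq_zero: "\<one>\<^bsub>R\<^esub> \<noteq> \<zero>\<^bsub>R\<^esub>"

locale partial_projective_rep =
  K?: field K + G?: group G + A?: nontrivial_unital_algebra K R
  for K (structure) and G (structure) and R (structure)
    and \<sigma> :: "'g \<Rightarrow> 'g \<Rightarrow> 'k" and \<Gamma> :: "'g \<Rightarrow> 'r" +
  assumes \<sigma>_closed: "\<sigma> \<in> carrier G \<rightarrow> carrier G \<rightarrow> carrier K"
    and \<Gamma>_closed: "\<Gamma> \<in> carrier G \<rightarrow> carrier R"
    and \<sigma>_zero_left:
      "\<lbrakk>g \<in> carrier G; h \<in> carrier G; \<sigma> g h = \<zero>\<^bsub>K\<^esub>\<rbrakk> \<Longrightarrow>
        \<Gamma> (inv\<^bsub>G\<^esub> g) \<otimes>\<^bsub>R\<^esub> \<Gamma> (g \<otimes>\<^bsub>G\<^esub> h) = \<zero>\<^bsub>R\<^esub>"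
    and \<sigma>_zero_right:
      "\<lbrakk>g \<in> carrier G; h \<in> carrier G; \<sigma> g h = \<zero>\<^bsub>K\<^esub>\<rbrakk> \<Longrightarrow>
        \<Gamma> (g \<otimes>\<^bsub>G\<^esub> h) \<otimes>\<^bsub>R\<^esub> \<Gamma> (inv\<^bsub>G\<^esub> h) = \<zero>\<^bsub>R\<^esub>"
    and \<Gamma>_mult_zero:
      "\<lbrakk>g \<in> carrier G; h \<in> carrier G; \<Gamma> g \<otimes>\<^bsub>R\<^esub> \<Gamma> h = \<zero>\<^bsub>R\<^esub>\<rbrakk> \<Longrightarrow> \<sigma> g h = \<zero>\<^bsub>K\<^esub>"
    and \<Gamma>_one: "\<Gamma> \<one>\<^bsub>G\<^esub> = \<one>\<^bsub>R\<^esub>"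
    and \<Gamma>_mult_left:
      "\<lbrakk>g \<in> carrier G; h \<in> carrier G\<rbrakk> \<Longrightarrow>
        \<Gamma> (inv\<^bsub>G\<^esub> g) \<otimes>\<^bsub>R\<^esub> \<Gamma> g \<otimes>\<^bsub>R\<^esub> \<Gamma> h =
        \<sigma> g h \<odot>\<^bsub>R\<^esub> (\<Gamma> (inv\<^bsub>G\<^esub> g) \<otimes>\<^bsub>R\<^esub> \<Gamma> (g \<otimes>\<^bsub>G\<^esub> h))"
    and \<Gamma>_mult_right:
      "\<lbrakk>g \<in> carrier G; h \<in> carrier G\<rbrakk> \<Longrightarrow>
        \<Gamma> g \<otimes>\<^bsub>R\<^esub> \<Gamma> h \<otimes>\<^bsub>R\<^esub> \<Gamma> (inv\<^bsub>G\<^esub> h) =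
        \<sigma> g h \<odot>\<^bsub>R\<^esub> (\<Gamma> (g \<otimes>\<^bsub>G\<^esub> h) \<otimes>\<^bsub>R\<^esub> \<Gamma> (inv\<^bsub>G\<^esub> h))"

text \<open>Quantification over all algebras is not possible inside a definition, so the type
  underlying the algebras is a parameter. A hypothesis \<open>\<sigma> \<in> pm TYPE('r) K G\<close> of a theorem
  with free type variable \<open>'r\<close> allows algebras of every type.\<close>

definition pm :: "'r itself \<Rightarrow> ('k, 'm) ring_scheme \<Rightarrow> ('g, 'n) monoid_scheme
    \<Rightarrow> ('g \<Rightarrow> 'g \<Rightarrow> 'k) set" where
  "pm _ K G = {\<sigma>. \<exists>(R :: ('k, 'r) module) \<Gamma>. partial_projective_rep K G R \<sigma> \<Gamma>}"


section \<open>Prohibitions\<close>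

definition Omega :: "('g, 'n) monoid_scheme \<Rightarrow> 'g set set" where
  "Omega G = {\<xi>. \<xi> \<subseteq> carrier G \<and> \<one>\<^bsub>G\<^esub> \<in> \<xi>}"

definition prohibitions_I :: "('k, 'm) ring_scheme \<Rightarrow> ('g, 'n) monoid_scheme
    \<Rightarrow> ('g \<Rightarrow> 'g \<Rightarrow> 'k) \<Rightarrow> 'g set set" where
  "prohibitions_I K G \<sigma> =
    {{h, h \<otimes>\<^bsub>G\<^esub> g, h \<otimes>\<^bsub>G\<^esub> g \<otimes>\<^bsub>G\<^esub> s} | h g s.
      h \<in> carrier G \<and> g \<in> carrier G \<and> s \<in> carrier G \<and> \<sigma> g s = \<zero>\<^bsub>K\<^esub>}"

definition prohibitions_II :: "('k, 'm) ring_scheme \<Rightarrow> ('g, 'n) monoid_scheme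
    \<Rightarrow> ('g \<Rightarrow> 'g \<Rightarrow> 'k) \<Rightarrow> 'g set set" where
  "prohibitions_II K G \<sigma> =
    {{h, h \<otimes>\<^bsub>G\<^esub> g, h \<otimes>\<^bsub>G\<^esub> g \<otimes>\<^bsub>G\<^esub> s, h \<otimes>\<^bsub>G\<^esub> g \<otimes>\<^bsub>G\<^esub> s \<otimes>\<^bsub>G\<^esub> t} | h g s t.
      h \<in> carrier G \<and> g \<in> carrier G \<and> s \<in> carrier G \<and> t \<in> carrier G \<and>
      \<sigma> g (s \<otimes>\<^bsub>G\<^esub> t) \<otimes>\<^bsub>K\<^esub> \<sigma> s t \<noteq> \<sigma> g s \<otimes>\<^bsub>K\<^esub> \<sigma> (g \<otimes>\<^bsub>G\<^esub> s) t}"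

definition prohibitions :: "('k, 'm) ring_scheme \<Rightarrow> ('g, 'n) monoid_scheme
    \<Rightarrow> ('g \<Rightarrow> 'g \<Rightarrow> 'k) \<Rightarrow> 'g set set" where
  "prohibitions K G \<sigma> = prohibitions_I K G \<sigma> \<union> prohibitions_II K G \<sigma>"

definition Omega_sigma :: "('k, 'm) ring_scheme \<Rightarrow> ('g, 'n) monoid_scheme
    \<Rightarrow> ('g \<Rightarrow> 'g \<Rightarrow> 'k) \<Rightarrow> 'g set set" where
  "Omega_sigma K G \<sigma> = {\<xi> \<in> Omega G. \<forall>V \<in> prohibitions K G \<sigma>. \<not> V \<subseteq> \<xi>}"

definition chi :: "('k, 'm) ring_scheme \<Rightarrow> ('g, 'n) monoid_scheme
    \<Rightarrow> ('g \<Rightarrow> 'g \<Rightarrow> 'k) \<Rightarrow> 'g set \<Rightarrow> 'k" where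
  "chi K G \<sigma> U = (if U \<in> Omega_sigma K G \<sigma> then \<one>\<^bsub>K\<^esub> else \<zero>\<^bsub>K\<^esub>)"


section \<open>Inverse monoids with a scalar action\<close>

record ('k, 't) scalar_monoid = "'t monoid" +
  zero_elem :: 't
  act :: "'k \<Rightarrow> 't \<Rightarrow> 't"

text \<open>The field \<open>one\<close> of the record plays no role in the next two locales.\<close>

locale kappa_semigroup = K?: field K
  for K :: "('k, 'm) ring_scheme" (structure)
    and T :: "('k, 't, 'n) scalar_monoid_scheme" (structure) +
  assumes mult_closed: "\<lbrakk>x \<in> carrier T; y \<in> carrier T\<rbrakk> \<Longrightarrow> x \<otimes>\<^bsub>T\<^esub> y \<in> carrier T"
    and mult_assoc: "\<lbrakk>x \<in> carrier T; y \<in> carrier T; z \<in> carrier T\<rbrakk> \<Longrightarrow>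
      x \<otimes>\<^bsub>T\<^esub> y \<otimes>\<^bsub>T\<^esub> z = x \<otimes>\<^bsub>T\<^esub> (y \<otimes>\<^bsub>T\<^esub> z)"
    and zero_elem_closed: "zero_elem T \<in> carrier T"
    and zero_elem_left: "x \<in> carrier T \<Longrightarrow> zero_elem T \<otimes>\<^bsub>T\<^esub> x = zero_elem T"
    and zero_elem_right: "x \<in> carrier T \<Longrightarrow> x \<otimes>\<^bsub>T\<^esub> zero_elem T = zero_elem T"
    and act_closed: "\<lbrakk>r \<in> carrier K; x \<in> carrier T\<rbrakk> \<Longrightarrow> act T r x \<in> carrier T"
    and act_act: "\<lbrakk>r \<in> carrier K; t \<in> carrier K; x \<in> carrier T\<rbrakk> \<Longrightarrow>
      act T r (act T t x) = act T (r \<otimes>\<^bsub>K\<^esub> t) x"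
    and act_mult_left: "\<lbrakk>r \<in> carrier K; x \<in> carrier T; y \<in> carrier T\<rbrakk> \<Longrightarrow>
      act T r (x \<otimes>\<^bsub>T\<^esub> y) = act T r x \<otimes>\<^bsub>T\<^esub> y"
    and act_mult_right: "\<lbrakk>r \<in> carrier K; x \<in> carrier T; y \<in> carrier T\<rbrakk> \<Longrightarrow>
      act T r (x \<otimes>\<^bsub>T\<^esub> y) = x \<otimes>\<^bsub>T\<^esub> act T r y"
    and act_one: "x \<in> carrier T \<Longrightarrow> act T \<one>\<^bsub>K\<^esub> x = x"
    and act_zero: "x \<in> carrier T \<Longrightarrow> act T \<zero>\<^bsub>K\<^esub> x = zero_elem T"

locale kappa_cancellative_semigroup = kappa_semigroup +
  assumes act_cancel:
    "\<lbrakk>r \<in> carrier K; t \<in> carrier K; x \<in> carrier T; x \<noteq> zero_elem T; act T r x = act T t x\<rbrakk>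
      \<Longrightarrow> r = t"

locale inverse_monoid = monoid +
  assumes ex1_inverse: "s \<in> carrier G \<Longrightarrow>
    \<exists>!t. t \<in> carrier G \<and> s \<otimes> t \<otimes> s = s \<and> t \<otimes> s \<otimes> t = t"

locale kappa_cancellative_inverse_monoid =
  kappa_cancellative_semigroup K T + inverse_monoid T
  for K :: "('k, 'm) ring_scheme" (structure)
    and T :: "('k, 't, 'n) scalar_monoid_scheme" (structure)


section \<open>The semigroup of a factor set\<close>

text \<open>\<open>Elem k U g\<close> stands for $k(U,g)$ with $k \neq 0$; the convention $0(U,g) = 0$ is
  implemented by \<open>mk_elem\<close>.\<close>

datatype ('k, 'g) selem = Zero | Elem 'k "'g set" 'g

definition mk_elem :: "('k, 'm) ring_scheme \<Rightarrow> 'k \<Rightarrow> 'g set \<Rightarrow> 'g \<Rightarrow> ('k, 'g) selem" where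
  "mk_elem K k U g = (if k = \<zero>\<^bsub>K\<^esub> then Zero else Elem k U g)"

fun selem_act :: "('k, 'm) ring_scheme \<Rightarrow> 'k \<Rightarrow> ('k, 'g) selem \<Rightarrow> ('k, 'g) selem" where
  "selem_act K r Zero = Zero"
| "selem_act K r (Elem k U g) =
    (if r = \<zero>\<^bsub>K\<^esub> then Zero else Elem (r \<otimes>\<^bsub>K\<^esub> k) U g)"

fun selem_mult :: "('k, 'm) ring_scheme \<Rightarrow> ('g, 'n) monoid_scheme \<Rightarrow> ('g \<Rightarrow> 'g \<Rightarrow> 'k)
    \<Rightarrow> ('k, 'g) selem \<Rightarrow> ('k, 'g) selem \<Rightarrow> ('k, 'g) selem" where
  "selem_mult K G \<sigma> Zero y = Zero"
| "selem_mult K G \<sigma> (Elem k U g) Zero = Zero"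
| "selem_mult K G \<sigma> (Elem k U g) (Elem r V h) =
    mk_elem K (\<sigma> g h \<otimes>\<^bsub>K\<^esub> chi K G \<sigma> (U \<union> (g <#\<^bsub>G\<^esub> V)) \<otimes>\<^bsub>K\<^esub> k \<otimes>\<^bsub>K\<^esub> r)
      (U \<union> (g <#\<^bsub>G\<^esub> V)) (g \<otimes>\<^bsub>G\<^esub> h)"

definition S_sigma :: "('k, 'm) ring_scheme \<Rightarrow> ('g, 'n) monoid_scheme \<Rightarrow> ('g \<Rightarrow> 'g \<Rightarrow> 'k)
    \<Rightarrow> ('k, ('k, 'g) selem) scalar_monoid" where
  "S_sigma K G \<sigma> = \<lparr>
     carrier = {Elem k U g | k U g. k \<in> carrier K \<and> U \<in> Omega_sigma K G \<sigma> \<and> g \<in> carrier G \<and>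
                  g \<in> U \<and> k \<noteq> \<zero>\<^bsub>K\<^esub> \<and> finite U} \<union> {Zero},
     mult = selem_mult K G \<sigma>,
     one = Elem \<one>\<^bsub>K\<^esub> {\<one>\<^bsub>G\<^esub>} \<one>\<^bsub>G\<^esub>,
     zero_elem = Zero,
     act = selem_act K\<rparr>"

end

theory Submission
  imports Defs
begin

text \<open>A factor set takes only the values \<open>0\<close> and \<open>1\<close> on pairs containing the identity, and
  \<open>\<sigma>(1,1) = 1\<close>; nothing else about the representation matters. The set \<open>\<P>\<^sub>\<sigma>\<close> is invariant
  under left translation, so \<open>\<Omega>\<^sub>\<sigma>\<close> is closed under subsets containing \<open>1\<close> and under
  \<open>U \<mapsto> x\<^sup>-\<^sup>1 U\<close> for \<open>x \<in> U\<close>. Hence both bracketings of \<open>(U,g)(V,h)(W,l)\<close> vanish unless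
  \<open>X = U \<union> gV \<union> ghW\<close> lies in \<open>\<Omega>\<^sub>\<sigma>\<close>, and in that case they agree because
  \<open>{1,g,gh,ghl} \<subseteq> X\<close> is not a prohibition of type II. The inverse of \<open>k(U,g)\<close> is
  \<open>(k \<sigma>(g,g\<^sup>-\<^sup>1))\<^sup>-\<^sup>1 (g\<^sup>-\<^sup>1 U, g\<^sup>-\<^sup>1)\<close>.\<close>

section \<open>Twists normalised at the identity and the structure \<open>S\<close>\<close>

locale normalised_twist =
  K?: field K + G?: group G
  for K (structure) and G (structure) and \<sigma> :: "'g \<Rightarrow> 'g \<Rightarrow> 'k" +
  assumes twist_closed [simp]:
      "\<lbrakk>g \<in> carrier G; h \<in> carrier G\<rbrakk> \<Longrightarrow> \<sigma> g h \<in> carrier K"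
    and twist_one_one: "\<sigma> \<one>\<^bsub>G\<^esub> \<one>\<^bsub>G\<^esub> = \<one>\<^bsub>K\<^esub>"
    and twist_one_right:
      "\<lbrakk>g \<in> carrier G; \<sigma> g \<one>\<^bsub>G\<^esub> \<noteq> \<zero>\<^bsub>K\<^esub>\<rbrakk> \<Longrightarrow> \<sigma> g \<one>\<^bsub>G\<^esub> = \<one>\<^bsub>K\<^esub>"
    and twist_one_left:
      "\<lbrakk>g \<in> carrier G; \<sigma> \<one>\<^bsub>G\<^esub> g \<noteq> \<zero>\<^bsub>K\<^esub>\<rbrakk> \<Longrightarrow> \<sigma> \<one>\<^bsub>G\<^esub> g = \<one>\<^bsub>K\<^esub>"
begin

abbreviation \<Omega> where "\<Omega> \<equiv> Omega_sigma K G \<sigma>"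
abbreviation S where "S \<equiv> S_sigma K G \<sigma>"

lemma S_simps [simp]:
  "mult S = selem_mult K G \<sigma>" "zero_elem S = Zero" "act S = selem_act K"
  "one S = Elem \<one>\<^bsub>K\<^esub> {\<one>\<^bsub>G\<^esub>} \<one>\<^bsub>G\<^esub>" "Zero \<in> carrier S"
  "Elem k U g \<in> carrier S \<longleftrightarrow>
    k \<in> carrier K \<and> k \<noteq> \<zero>\<^bsub>K\<^esub> \<and> U \<in> \<Omega> \<and> g \<in> U \<and> g \<in> carrier G \<and> finite U"
  by (auto simp: S_sigma_def)

lemma selem_mult_Zero [simp]: "selem_mult K G \<sigma> x Zero = Zero"
  by (cases x) auto

section \<open>The family \<open>\<Omega>\<close> and its closure properties\<close>

text \<open>Containment of a prohibition is turned into membership of its points. In this form the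
  base point \<open>h\<close> can be set to the identity or shifted by a translation.\<close>

lemma Omega_sigma_iff:
  "U \<in> \<Omega> \<longleftrightarrow> U \<subseteq> carrier G \<and> \<one>\<^bsub>G\<^esub> \<in> U \<and>
    (\<forall>h\<in>carrier G. \<forall>g\<in>carrier G. \<forall>s\<in>carrier G.
      h \<in> U \<and> h \<otimes>\<^bsub>G\<^esub> g \<in> U \<and> h \<otimes>\<^bsub>G\<^esub> g \<otimes>\<^bsub>G\<^esub> s \<in> U \<longrightarrow> \<sigma> g s \<noteq> \<zero>\<^bsub>K\<^esub>) \<and>
    (\<forall>h\<in>carrier G. \<forall>g\<in>carrier G. \<forall>s\<in>carrier G. \<forall>t\<in>carrier G.
      h \<in> U \<and> h \<otimes>\<^bsub>G\<^esub> g \<in> U \<and> h \<otimes>\<^bsub>G\<^esub> g \<otimes>\<^bsub>G\<^esub> s \<in> U \<and> h \<otimes>\<^bsub>G\<^esub> g \<otimes>\<^bsub>G\<^esub> s \<otimes>\<^bsub>G\<^esub> t \<in> U \<longrightarrow>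
      \<sigma> g (s \<otimes>\<^bsub>G\<^esub> t) \<otimes>\<^bsub>K\<^esub> \<sigma> s t = \<sigma> g s \<otimes>\<^bsub>K\<^esub> \<sigma> (g \<otimes>\<^bsub>G\<^esub> s) t)"
proof -
  have I: "(\<forall>V\<in>prohibitions_I K G \<sigma>. \<not> V \<subseteq> U) \<longleftrightarrow>
    (\<forall>h\<in>carrier G. \<forall>g\<in>carrier G. \<forall>s\<in>carrier G.
      h \<in> U \<and> h \<otimes>\<^bsub>G\<^esub> g \<in> U \<and> h \<otimes>\<^bsub>G\<^esub> g \<otimes>\<^bsub>G\<^esub> s \<in> U \<longrightarrow> \<sigma> g s \<noteq> \<zero>\<^bsub>K\<^esub>)"
    unfolding prohibitions_I_def by simp blast
  have II: "(\<forall>V\<in>prohibitions_II K G \<sigma>. \<not> V \<subseteq> U) \<longleftrightarrow>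
    (\<forall>h\<in>carrier G. \<forall>g\<in>carrier G. \<forall>s\<in>carrier G. \<forall>t\<in>carrier G.
      h \<in> U \<and> h \<otimes>\<^bsub>G\<^esub> g \<in> U \<and> h \<otimes>\<^bsub>G\<^esub> g \<otimes>\<^bsub>G\<^esub> s \<in> U \<and> h \<otimes>\<^bsub>G\<^esub> g \<otimes>\<^bsub>G\<^esub> s \<otimes>\<^bsub>G\<^esub> t \<in> U \<longrightarrow>
      \<sigma> g (s \<otimes>\<^bsub>G\<^esub> t) \<otimes>\<^bsub>K\<^esub> \<sigma> s t = \<sigma> g s \<otimes>\<^bsub>K\<^esub> \<sigma> (g \<otimes>\<^bsub>G\<^esub> s) t)"
    unfolding prohibitions_II_def by simp blast
  show ?thesis
    unfolding Omega_sigma_def Omega_def prohibitions_def mem_Collect_eq ball_Un I II by simp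
qed

lemma Omega_sigma_subset: "U \<in> \<Omega> \<Longrightarrow> U \<subseteq> carrier G"
  by (simp add: Omega_sigma_iff)

lemma Omega_sigma_one: "U \<in> \<Omega> \<Longrightarrow> \<one>\<^bsub>G\<^esub> \<in> U"
  by (simp add: Omega_sigma_iff)

text \<open>A prohibition contained in \<open>V\<close> would also be contained in
  \<open>U\<close>.\<close>

lemma Omega_sigma_antimono:
  assumes "U \<in> \<Omega>" "V \<subseteq> U" "\<one>\<^bsub>G\<^esub> \<in> V"
  shows "V \<in> \<Omega>"
  using assms unfolding Omega_sigma_def Omega_def by blast

text \<open>With the identity as base point, a type I prohibition is \<open>{1, g, gs}\<close>, and
  the identity always lies in \<open>U\<close>.\<close>

lemma twist_nonzero:
  assumes "U \<in> \<Omega>" "g \<in> U" "g \<otimes>\<^bsub>G\<^esub> s \<in> U" "g \<in> carrier G" "s \<in> carrier G"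
  shows "\<sigma> g s \<noteq> \<zero>\<^bsub>K\<^esub>"
proof -
  have "\<one>\<^bsub>G\<^esub> \<otimes>\<^bsub>G\<^esub> g \<in> U" "\<one>\<^bsub>G\<^esub> \<otimes>\<^bsub>G\<^esub> g \<otimes>\<^bsub>G\<^esub> s \<in> U" "\<one>\<^bsub>G\<^esub> \<in> U"
    using assms Omega_sigma_one by auto
  then show ?thesis
    using assms(1,4,5) G.one_closed unfolding Omega_sigma_iff by blast
qed

text \<open>The type II counterpart: \<open>{1, g, gs, gst}\<close> is contained in
  \<open>U\<close>, so it is not a prohibition.\<close>

lemma twist_cocycle:
  assumes "U \<in> \<Omega>" "g \<in> U" "g \<otimes>\<^bsub>G\<^esub> s \<in> U" "g \<otimes>\<^bsub>G\<^esub> s \<otimes>\<^bsub>G\<^esub> t \<in> U"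
    "g \<in> carrier G" "s \<in> carrier G" "t \<in> carrier G"
  shows "\<sigma> g (s \<otimes>\<^bsub>G\<^esub> t) \<otimes>\<^bsub>K\<^esub> \<sigma> s t = \<sigma> g s \<otimes>\<^bsub>K\<^esub> \<sigma> (g \<otimes>\<^bsub>G\<^esub> s) t"
proof -
  have "\<one>\<^bsub>G\<^esub> \<otimes>\<^bsub>G\<^esub> g \<in> U" "\<one>\<^bsub>G\<^esub> \<otimes>\<^bsub>G\<^esub> g \<otimes>\<^bsub>G\<^esub> s \<in> U" "\<one>\<^bsub>G\<^esub> \<otimes>\<^bsub>G\<^esub> g \<otimes>\<^bsub>G\<^esub> s \<otimes>\<^bsub>G\<^esub> t \<in> U" "\<one>\<^bsub>G\<^esub> \<in> U"
    using assms Omega_sigma_one by auto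
  then show ?thesis
    using assms(1,5-7) G.one_closed unfolding Omega_sigma_iff by blast
qed

text \<open>The pairs \<open>(g, 1)\<close> and \<open>(1, g)\<close> have all their partial
  products in \<open>{1, g}\<close>, which is contained in \<open>U\<close>. Hence the twist does
  not vanish on them, and normalisation leaves only the value 1.\<close>

lemma twist_one:
  assumes "U \<in> \<Omega>" "g \<in> U"
  shows "\<sigma> g \<one>\<^bsub>G\<^esub> = \<one>\<^bsub>K\<^esub>" "\<sigma> \<one>\<^bsub>G\<^esub> g = \<one>\<^bsub>K\<^esub>"
proof -
  have g: "g \<in> carrier G"
    using assms Omega_sigma_subset by blast
  show "\<sigma> g \<one>\<^bsub>G\<^esub> = \<one>\<^bsub>K\<^esub>"
    using twist_nonzero[OF assms(1), of g "\<one>\<^bsub>G\<^esub>"] twist_one_right assms g by simp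
  show "\<sigma> \<one>\<^bsub>G\<^esub> g = \<one>\<^bsub>K\<^esub>"
    using twist_nonzero[OF assms(1), of "\<one>\<^bsub>G\<^esub>" g] twist_one_left assms g Omega_sigma_one
    by simp
qed

text \<open>A configuration inside \<open>{1}\<close> has all its group elements equal to 1, so only
  the value of the twist at \<open>(1, 1)\<close> is tested.\<close>

lemma singleton_one_Omega_sigma: "{\<one>\<^bsub>G\<^esub>} \<in> \<Omega>"
  unfolding Omega_sigma_iff by (auto simp: twist_one_one)

text \<open>A prohibition with base point \<open>h\<close> in the translate would give the one with
  base point \<open>xh\<close> and the same remaining data in \<open>U\<close>. The assumption
  \<open>x \<in> U\<close> puts the identity into the translate.\<close>

lemma translate_Omega_sigma:
  assumes "U \<in> \<Omega>" "x \<in> U"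
  shows "inv\<^bsub>G\<^esub> x <#\<^bsub>G\<^esub> U \<in> \<Omega>"
proof -
  have x: "x \<in> carrier G" and U: "U \<subseteq> carrier G"
    using assms Omega_sigma_subset by auto
  have mem: "y \<in> inv\<^bsub>G\<^esub> x <#\<^bsub>G\<^esub> U \<longleftrightarrow> x \<otimes>\<^bsub>G\<^esub> y \<in> U" if "y \<in> carrier G" for y
    using that x U by (force simp: l_coset_def G.m_assoc[symmetric])
  have "inv\<^bsub>G\<^esub> x <#\<^bsub>G\<^esub> U \<subseteq> carrier G"
    using x U by (simp add: G.l_coset_subset_G)
  moreover have "\<one>\<^bsub>G\<^esub> \<in> inv\<^bsub>G\<^esub> x <#\<^bsub>G\<^esub> U"
    using assms x by (simp add: mem)
  \<comment> \<open>\<open>G.m_closed[OF x]\<close> makes \<open>xh\<close> available as a base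
    point when the conditions on \<open>U\<close> are instantiated.\<close>
  ultimately show ?thesis
    using assms(1) x G.m_closed[OF x] unfolding Omega_sigma_iff
    by (simp add: mem G.m_assoc[symmetric]) blast
qed

section \<open>Products: closure, associativity and identity\<close>

lemma finite_l_coset: "finite U \<Longrightarrow> finite (g <#\<^bsub>G\<^esub> U)"
  by (simp add: l_coset_def)

lemma l_coset_Un: "g <#\<^bsub>G\<^esub> (U \<union> V) = (g <#\<^bsub>G\<^esub> U) \<union> (g <#\<^bsub>G\<^esub> V)"
  by (auto simp: l_coset_def)

lemma l_coset_memI: "h \<in> V \<Longrightarrow> g \<otimes>\<^bsub>G\<^esub> h \<in> g <#\<^bsub>G\<^esub> V"
  by (auto simp: l_coset_def)

text \<open>When the union lies in \<open>\<Omega>\<close>, the twist cannot vanish, since 1,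
  \<open>g\<close> and \<open>gh\<close> all belong to that union. So \<open>chi\<close> alone
  decides whether the product is \<open>Zero\<close>, and later computations are free of
  \<open>mk_elem\<close>.\<close>

lemma selem_mult_Elem:
  assumes "Elem k U g \<in> carrier S" "Elem r V h \<in> carrier S"
  shows "selem_mult K G \<sigma> (Elem k U g) (Elem r V h) =
    (if U \<union> (g <#\<^bsub>G\<^esub> V) \<in> \<Omega>
     then Elem (\<sigma> g h \<otimes>\<^bsub>K\<^esub> k \<otimes>\<^bsub>K\<^esub> r) (U \<union> (g <#\<^bsub>G\<^esub> V)) (g \<otimes>\<^bsub>G\<^esub> h) else Zero)"
proof (cases "U \<union> (g <#\<^bsub>G\<^esub> V) \<in> \<Omega>")
  case True
  have "\<sigma> g h \<noteq> \<zero>\<^bsub>K\<^esub>"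
    using assms by (intro twist_nonzero[OF True]) (auto simp: l_coset_memI)
  then show ?thesis
    using assms True by (simp add: chi_def mk_elem_def K.integral_iff)
next
  case False
  then show ?thesis
    using assms by (simp add: chi_def mk_elem_def)
qed

lemma selem_mult_closed:
  assumes "x \<in> carrier S" "y \<in> carrier S"
  shows "selem_mult K G \<sigma> x y \<in> carrier S"
proof (cases "x = Zero \<or> y = Zero")
  case False
  then obtain k U g r V h where xy: "x = Elem k U g" "y = Elem r V h"
    by (metis selem.exhaust)
  have nz: "\<sigma> g h \<noteq> \<zero>\<^bsub>K\<^esub>" if "U \<union> (g <#\<^bsub>G\<^esub> V) \<in> \<Omega>"
    using assms by (intro twist_nonzero[OF that]) (auto simp: l_coset_memI xy)
  show ?thesis
    unfolding xy selem_mult_Elem[OF assms[unfolded xy]]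
    using assms nz by (simp add: xy K.integral_iff l_coset_memI finite_l_coset)
qed auto

lemma selem_mult_assoc:
  assumes "x \<in> carrier S" "y \<in> carrier S" "z \<in> carrier S"
  shows "selem_mult K G \<sigma> (selem_mult K G \<sigma> x y) z = selem_mult K G \<sigma> x (selem_mult K G \<sigma> y z)"
proof (cases "x = Zero \<or> y = Zero \<or> z = Zero")
  case False
  then obtain k U g r V h q W l
    where xyz: "x = Elem k U g" "y = Elem r V h" "z = Elem q W l"
    by (metis selem.exhaust)
  define X where "X = U \<union> (g <#\<^bsub>G\<^esub> V) \<union> (g \<otimes>\<^bsub>G\<^esub> h <#\<^bsub>G\<^esub> W)"
  note mem = assms[unfolded xyz]
  have car: "k \<in> carrier K" "r \<in> carrier K" "q \<in> carrier K"
    "g \<in> carrier G" "h \<in> carrier G" "l \<in> carrier G"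
    and sub: "U \<subseteq> carrier G" "V \<subseteq> carrier G" "W \<subseteq> carrier G"
    and one: "\<one>\<^bsub>G\<^esub> \<in> U" "\<one>\<^bsub>G\<^esub> \<in> V"
    and gh: "g \<in> U" "h \<in> V" "l \<in> W"
    using mem Omega_sigma_subset Omega_sigma_one by auto
  have X: "U \<union> (g <#\<^bsub>G\<^esub> (V \<union> (h <#\<^bsub>G\<^esub> W))) = X"
    using car sub by (simp add: X_def l_coset_Un G.lcos_m_assoc Un_assoc)
  \<comment> \<open>The support of the first partial product is a subset of \<open>X\<close>
    containing the identity.\<close>
  have left: "U \<union> (g <#\<^bsub>G\<^esub> V) \<in> \<Omega>" if "X \<in> \<Omega>"
    using one by (intro Omega_sigma_antimono[OF that]) (auto simp: X_def)
  \<comment> \<open>Here it is the translate by \<open>g\<close> of the support of \<open>yz\<close>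
    that lies in \<open>X\<close>. Translating \<open>X\<close> back by \<open>inv g\<close> is
    allowed because \<open>g \<in> X\<close>.\<close>
  have right: "V \<union> (h <#\<^bsub>G\<^esub> W) \<in> \<Omega>" if "X \<in> \<Omega>"
  proof (rule Omega_sigma_antimono)
    show "inv\<^bsub>G\<^esub> g <#\<^bsub>G\<^esub> X \<in> \<Omega>"
      using gh by (intro translate_Omega_sigma[OF that]) (simp add: X_def)
    have "V \<union> (h <#\<^bsub>G\<^esub> W) \<subseteq> carrier G"
      using sub car by (simp add: G.l_coset_subset_G)
    then have "inv\<^bsub>G\<^esub> g <#\<^bsub>G\<^esub> (g <#\<^bsub>G\<^esub> (V \<union> (h <#\<^bsub>G\<^esub> W))) = V \<union> (h <#\<^bsub>G\<^esub> W)"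
      using car by (simp add: G.lcos_m_assoc G.lcos_mult_one)
    then show "V \<union> (h <#\<^bsub>G\<^esub> W) \<subseteq> inv\<^bsub>G\<^esub> g <#\<^bsub>G\<^esub> X"
      unfolding X[symmetric] l_coset_Un[of _ U] by blast
  qed (use one in auto)
  \<comment> \<open>The partial products \<open>g\<close>, \<open>gh\<close> and \<open>ghl\<close>
    lie in \<open>X\<close>, so the cocycle identity holds for \<open>(g, h, l)\<close>; it is
    multiplied by the three coefficients.\<close>
  have cocycle: "\<sigma> (g \<otimes>\<^bsub>G\<^esub> h) l \<otimes>\<^bsub>K\<^esub> (\<sigma> g h \<otimes>\<^bsub>K\<^esub> k \<otimes>\<^bsub>K\<^esub> r) \<otimes>\<^bsub>K\<^esub> q =
      \<sigma> g (h \<otimes>\<^bsub>G\<^esub> l) \<otimes>\<^bsub>K\<^esub> k \<otimes>\<^bsub>K\<^esub> (\<sigma> h l \<otimes>\<^bsub>K\<^esub> r \<otimes>\<^bsub>K\<^esub> q)" if "X \<in> \<Omega>"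
  proof -
    have "\<sigma> g (h \<otimes>\<^bsub>G\<^esub> l) \<otimes>\<^bsub>K\<^esub> \<sigma> h l = \<sigma> g h \<otimes>\<^bsub>K\<^esub> \<sigma> (g \<otimes>\<^bsub>G\<^esub> h) l"
      using car gh by (intro twist_cocycle[OF that]) (auto simp: X_def l_coset_memI)
    then have "(\<sigma> g h \<otimes>\<^bsub>K\<^esub> \<sigma> (g \<otimes>\<^bsub>G\<^esub> h) l) \<otimes>\<^bsub>K\<^esub> (k \<otimes>\<^bsub>K\<^esub> r \<otimes>\<^bsub>K\<^esub> q) =
        (\<sigma> g (h \<otimes>\<^bsub>G\<^esub> l) \<otimes>\<^bsub>K\<^esub> \<sigma> h l) \<otimes>\<^bsub>K\<^esub> (k \<otimes>\<^bsub>K\<^esub> r \<otimes>\<^bsub>K\<^esub> q)"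
      by simp
    then show ?thesis
      using car by (simp add: K.m_ac)
  qed
  have xy: "selem_mult K G \<sigma> x y \<in> carrier S" and yz: "selem_mult K G \<sigma> y z \<in> carrier S"
    using assms selem_mult_closed by auto
  \<comment> \<open>Carrier membership is kept folded by deleting \<open>S_simps\<close>, so that
    the facts \<open>xy\<close> and \<open>mem\<close> match the premises of
    \<open>selem_mult_Elem\<close> directly.\<close>
  have "selem_mult K G \<sigma> (selem_mult K G \<sigma> x y) z =
    (if X \<in> \<Omega> then Elem (\<sigma> (g \<otimes>\<^bsub>G\<^esub> h) l \<otimes>\<^bsub>K\<^esub> (\<sigma> g h \<otimes>\<^bsub>K\<^esub> k \<otimes>\<^bsub>K\<^esub> r) \<otimes>\<^bsub>K\<^esub> q) X (g \<otimes>\<^bsub>G\<^esub> h \<otimes>\<^bsub>G\<^esub> l)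
     else Zero)"
    using left xy mem(3)
    by (auto simp: xyz selem_mult_Elem[OF mem(1,2)] selem_mult_Elem X_def[symmetric]
        simp del: S_simps selem_mult.simps(3) split: if_splits)
  moreover have "selem_mult K G \<sigma> x (selem_mult K G \<sigma> y z) =
    (if X \<in> \<Omega> then Elem (\<sigma> g (h \<otimes>\<^bsub>G\<^esub> l) \<otimes>\<^bsub>K\<^esub> k \<otimes>\<^bsub>K\<^esub> (\<sigma> h l \<otimes>\<^bsub>K\<^esub> r \<otimes>\<^bsub>K\<^esub> q)) X (g \<otimes>\<^bsub>G\<^esub> (h \<otimes>\<^bsub>G\<^esub> l))
     else Zero)"
    using right yz mem(1)
    by (auto simp: xyz selem_mult_Elem[OF mem(2,3)] selem_mult_Elem X
        simp del: S_simps selem_mult.simps(3) split: if_splits)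
  ultimately show ?thesis
    using cocycle car by (simp add: G.m_assoc)
qed auto

lemma selem_one_closed: "Elem \<one>\<^bsub>K\<^esub> {\<one>\<^bsub>G\<^esub>} \<one>\<^bsub>G\<^esub> \<in> carrier S"
  by (simp add: singleton_one_Omega_sigma)

text \<open>Multiplying by the identity leaves the support unchanged, as 1 and \<open>g\<close>
  already belong to \<open>U\<close>; the twists involved are 1 by \<open>twist_one\<close>.\<close>

lemma selem_mult_one:
  assumes "x \<in> carrier S"
  shows "selem_mult K G \<sigma> (Elem \<one>\<^bsub>K\<^esub> {\<one>\<^bsub>G\<^esub>} \<one>\<^bsub>G\<^esub>) x = x"
    and "selem_mult K G \<sigma> x (Elem \<one>\<^bsub>K\<^esub> {\<one>\<^bsub>G\<^esub>} \<one>\<^bsub>G\<^esub>) = x"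
proof (atomize (full), cases x)
  case (Elem k U g)
  note mem = assms[unfolded Elem]
  have U: "U \<subseteq> carrier G" "\<one>\<^bsub>G\<^esub> \<in> U"
    using mem Omega_sigma_subset Omega_sigma_one by auto
  then have eq: "insert \<one>\<^bsub>G\<^esub> (\<one>\<^bsub>G\<^esub> <#\<^bsub>G\<^esub> U) = U"
    by (simp add: G.lcos_mult_one insert_absorb)
  have eq': "insert g U = U" "g <#\<^bsub>G\<^esub> {\<one>\<^bsub>G\<^esub>} = {g}"
    using mem by (auto simp: l_coset_def)
  have "\<sigma> g \<one>\<^bsub>G\<^esub> = \<one>\<^bsub>K\<^esub>" "\<sigma> \<one>\<^bsub>G\<^esub> g = \<one>\<^bsub>K\<^esub>"
    using mem twist_one by auto
  then show "selem_mult K G \<sigma> (Elem \<one>\<^bsub>K\<^esub> {\<one>\<^bsub>G\<^esub>} \<one>\<^bsub>G\<^esub>) x = x \<and>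
      selem_mult K G \<sigma> x (Elem \<one>\<^bsub>K\<^esub> {\<one>\<^bsub>G\<^esub>} \<one>\<^bsub>G\<^esub>) = x"
    using mem unfolding Elem selem_mult_Elem[OF mem selem_one_closed]
      selem_mult_Elem[OF selem_one_closed mem] by (simp add: eq eq')
qed simp

section \<open>The scalar action\<close>

lemma selem_act_mult:
  assumes "c \<in> carrier K" "x \<in> carrier S" "y \<in> carrier S"
  shows "selem_act K c (selem_mult K G \<sigma> x y) = selem_mult K G \<sigma> (selem_act K c x) y"
    and "selem_act K c (selem_mult K G \<sigma> x y) = selem_mult K G \<sigma> x (selem_act K c y)"
\<comment> \<open>Scaling by zero yields \<open>Zero\<close> and not an \<open>Elem\<close> with
  coefficient zero, so that case is split off before \<open>selem_mult_Elem\<close> is applied to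
  scaled factors.\<close>
proof (atomize (full), cases "x = Zero \<or> y = Zero \<or> c = \<zero>\<^bsub>K\<^esub>")
  case True
  have "selem_act K \<zero>\<^bsub>K\<^esub> z = Zero" for z :: "('k, 'g) selem"
    by (cases z) auto
  then show "selem_act K c (selem_mult K G \<sigma> x y) = selem_mult K G \<sigma> (selem_act K c x) y \<and>
    selem_act K c (selem_mult K G \<sigma> x y) = selem_mult K G \<sigma> x (selem_act K c y)"
    using True by auto
next
  case False
  then obtain k U g r V h where xy: "x = Elem k U g" "y = Elem r V h" and c: "c \<noteq> \<zero>\<^bsub>K\<^esub>"
    by (metis selem.exhaust)
  note mem = assms(2,3)[unfolded xy]
  have cmem: "Elem (c \<otimes>\<^bsub>K\<^esub> k) U g \<in> carrier S" "Elem (c \<otimes>\<^bsub>K\<^esub> r) V h \<in> carrier S"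
    using mem assms(1) c by (auto simp: K.integral_iff)
  show "selem_act K c (selem_mult K G \<sigma> x y) = selem_mult K G \<sigma> (selem_act K c x) y \<and>
    selem_act K c (selem_mult K G \<sigma> x y) = selem_mult K G \<sigma> x (selem_act K c y)"
    using mem assms(1) c unfolding xy selem_mult_Elem[OF mem] selem_act.simps if_not_P[OF c]
      selem_mult_Elem[OF cmem(1) mem(2)] selem_mult_Elem[OF mem(1) cmem(2)]
    by (simp add: K.m_ac)
qed

lemma kappa_cancellative_semigroup_S: "kappa_cancellative_semigroup K S"
proof unfold_locales
  show "act S c x \<in> carrier S" if "c \<in> carrier K" "x \<in> carrier S" for c x
    using that by (cases x) (auto simp: K.integral_iff)
  show "act S \<one>\<^bsub>K\<^esub> x = x" "act S \<zero>\<^bsub>K\<^esub> x = zero_elem S" if "x \<in> carrier S" for x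
    using that by (cases x; simp)+
  show "act S c (act S t x) = act S (c \<otimes>\<^bsub>K\<^esub> t) x"
    if "c \<in> carrier K" "t \<in> carrier K" "x \<in> carrier S" for c t x
    using that by (cases x) (auto simp: K.m_assoc K.integral_iff)
  \<comment> \<open>The action on \<open>Elem\<close> gives \<open>Zero\<close> exactly for the zero
    scalar; otherwise the nonzero coefficient of \<open>x\<close> is cancelled.\<close>
  show "c = t"
    if "c \<in> carrier K" "t \<in> carrier K" "x \<in> carrier S" "x \<noteq> zero_elem S"
      "act S c x = act S t x" for c t x
    using that by (cases x) (auto simp: K.m_rcancel split: if_splits)
qed (auto intro: selem_mult_closed selem_mult_assoc selem_act_mult)

section \<open>Existence and uniqueness of inverses\<close>

text \<open>Comparing group components forces \<open>gh = 1\<close>. The support of the triple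
  product is then \<open>U \<union> gV\<close>, which equals \<open>U\<close> exactly when
  \<open>gV \<subseteq> U\<close>, and comparing coefficients allows one factor \<open>k\<close> to
  be cancelled. Exchanging the two elements gives the other equation for an inverse.\<close>

lemma selem_mult_mult_self_iff:
  assumes "Elem k U g \<in> carrier S" "Elem r V h \<in> carrier S"
  shows "selem_mult K G \<sigma> (selem_mult K G \<sigma> (Elem k U g) (Elem r V h)) (Elem k U g) = Elem k U g
    \<longleftrightarrow> h = inv\<^bsub>G\<^esub> g \<and> g <#\<^bsub>G\<^esub> V \<subseteq> U \<and> \<sigma> g (inv\<^bsub>G\<^esub> g) \<otimes>\<^bsub>K\<^esub> k \<otimes>\<^bsub>K\<^esub> r = \<one>\<^bsub>K\<^esub>" (is "?L \<longleftrightarrow> ?R")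
proof -
  have car: "k \<in> carrier K" "r \<in> carrier K" "g \<in> carrier G" "h \<in> carrier G" "k \<noteq> \<zero>\<^bsub>K\<^esub>"
    and U: "U \<in> \<Omega>" "U \<subseteq> carrier G" "g \<in> U"
    using assms Omega_sigma_subset by auto
  have step: "selem_mult K G \<sigma> (selem_mult K G \<sigma> (Elem k U g) (Elem r V h)) (Elem k U g) =
      (if U \<union> (g <#\<^bsub>G\<^esub> V) \<in> \<Omega> \<and> U \<union> (g <#\<^bsub>G\<^esub> V) \<union> (g \<otimes>\<^bsub>G\<^esub> h <#\<^bsub>G\<^esub> U) \<in> \<Omega>
       then Elem (\<sigma> (g \<otimes>\<^bsub>G\<^esub> h) g \<otimes>\<^bsub>K\<^esub> (\<sigma> g h \<otimes>\<^bsub>K\<^esub> k \<otimes>\<^bsub>K\<^esub> r) \<otimes>\<^bsub>K\<^esub> k)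
         (U \<union> (g <#\<^bsub>G\<^esub> V) \<union> (g \<otimes>\<^bsub>G\<^esub> h <#\<^bsub>G\<^esub> U)) (g \<otimes>\<^bsub>G\<^esub> h \<otimes>\<^bsub>G\<^esub> g) else Zero)"
    using selem_mult_closed[OF assms] assms(1)
    by (auto simp: selem_mult_Elem[OF assms] selem_mult_Elem
        simp del: S_simps selem_mult.simps(3) split: if_splits)
  have coeff: "\<sigma> \<one>\<^bsub>G\<^esub> g \<otimes>\<^bsub>K\<^esub> (\<sigma> g h \<otimes>\<^bsub>K\<^esub> k \<otimes>\<^bsub>K\<^esub> r) \<otimes>\<^bsub>K\<^esub> k = k \<longleftrightarrow>
      \<sigma> g h \<otimes>\<^bsub>K\<^esub> k \<otimes>\<^bsub>K\<^esub> r = \<one>\<^bsub>K\<^esub>"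
    using car twist_one[OF U(1,3)] K.m_rcancel[of k "\<sigma> g h \<otimes>\<^bsub>K\<^esub> k \<otimes>\<^bsub>K\<^esub> r" "\<one>\<^bsub>K\<^esub>"] by simp
  have inv: "h = inv\<^bsub>G\<^esub> g" if "g \<otimes>\<^bsub>G\<^esub> h \<otimes>\<^bsub>G\<^esub> g = g"
  proof -
    have "g \<otimes>\<^bsub>G\<^esub> h = \<one>\<^bsub>G\<^esub>"
      using that car G.r_cancel_one[of g "g \<otimes>\<^bsub>G\<^esub> h"] by simp
    then show ?thesis
      using car G.inv_equality G.inv_comm by metis
  qed
  show ?thesis
  proof
    assume L: ?L
    then have eqs: "g \<otimes>\<^bsub>G\<^esub> h \<otimes>\<^bsub>G\<^esub> g = g" "U \<union> (g <#\<^bsub>G\<^esub> V) \<union> (g \<otimes>\<^bsub>G\<^esub> h <#\<^bsub>G\<^esub> U) = U"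
      "\<sigma> (g \<otimes>\<^bsub>G\<^esub> h) g \<otimes>\<^bsub>K\<^esub> (\<sigma> g h \<otimes>\<^bsub>K\<^esub> k \<otimes>\<^bsub>K\<^esub> r) \<otimes>\<^bsub>K\<^esub> k = k"
      unfolding step by (auto split: if_splits)
    have h: "h = inv\<^bsub>G\<^esub> g"
      using eqs(1) by (rule inv)
    then show ?R
      using eqs coeff car by auto
  next
    assume R: ?R
    then have h: "g \<otimes>\<^bsub>G\<^esub> h = \<one>\<^bsub>G\<^esub>" and X: "U \<union> (g <#\<^bsub>G\<^esub> V) = U"
      using car by auto
    show ?L
      unfolding step h X using U car coeff R by (simp add: G.lcos_mult_one)
  qed
qed

text \<open>The cocycle identity for \<open>(g, inv g, g)\<close>, whose partial products
  \<open>g\<close>, 1, \<open>g\<close> lie in \<open>U\<close>; the two remaining twists are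
  1.\<close>

lemma twist_inv_commute:
  assumes "U \<in> \<Omega>" "g \<in> U"
  shows "\<sigma> (inv\<^bsub>G\<^esub> g) g = \<sigma> g (inv\<^bsub>G\<^esub> g)"
proof -
  have g: "g \<in> carrier G"
    using assms Omega_sigma_subset by blast
  then have "\<sigma> g (inv\<^bsub>G\<^esub> g \<otimes>\<^bsub>G\<^esub> g) \<otimes>\<^bsub>K\<^esub> \<sigma> (inv\<^bsub>G\<^esub> g) g =
      \<sigma> g (inv\<^bsub>G\<^esub> g) \<otimes>\<^bsub>K\<^esub> \<sigma> (g \<otimes>\<^bsub>G\<^esub> inv\<^bsub>G\<^esub> g) g"
    using assms Omega_sigma_one by (intro twist_cocycle[OF assms(1)]) auto
  then show ?thesis
    using g twist_one[OF assms] by simp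
qed

lemma selem_inverse:
  assumes "s \<in> carrier S"
  shows "\<exists>!t. t \<in> carrier S \<and> selem_mult K G \<sigma> (selem_mult K G \<sigma> s t) s = s \<and>
    selem_mult K G \<sigma> (selem_mult K G \<sigma> t s) t = t"
proof (cases s)
  case Zero
  then show ?thesis
    by (auto intro!: ex1I[of _ Zero])
next
  case (Elem k U g)
  note mem = assms[unfolded Elem]
  have car: "k \<in> carrier K" "g \<in> carrier G" "k \<noteq> \<zero>\<^bsub>K\<^esub>" "finite U"
    and U: "U \<in> \<Omega>" "U \<subseteq> carrier G" "g \<in> U" "\<one>\<^bsub>G\<^esub> \<in> U"
    using mem Omega_sigma_subset Omega_sigma_one by auto
  \<comment> \<open>With this scalar, the coefficient condition for \<open>Elem r V h\<close> to
    satisfy \<open>sts = s\<close> becomes \<open>c \<otimes> r = 1\<close>.\<close>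
  define c where "c = \<sigma> g (inv\<^bsub>G\<^esub> g) \<otimes>\<^bsub>K\<^esub> k"
  have "\<sigma> g (inv\<^bsub>G\<^esub> g) \<noteq> \<zero>\<^bsub>K\<^esub>"
    using car U by (intro twist_nonzero[OF U(1)]) auto
  then have c: "c \<in> carrier K" "c \<noteq> \<zero>\<^bsub>K\<^esub>"
    using car by (auto simp: c_def K.integral_iff)
  then have ic: "inv\<^bsub>K\<^esub> c \<in> carrier K" "inv\<^bsub>K\<^esub> c \<noteq> \<zero>\<^bsub>K\<^esub>" "c \<otimes>\<^bsub>K\<^esub> inv\<^bsub>K\<^esub> c = \<one>\<^bsub>K\<^esub>"
    using K.field_Units by auto
  let ?V = "inv\<^bsub>G\<^esub> g <#\<^bsub>G\<^esub> U"
  let ?t = "Elem (inv\<^bsub>K\<^esub> c) ?V (inv\<^bsub>G\<^esub> g)"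
  have gV: "g <#\<^bsub>G\<^esub> ?V = U"
    using car U by (simp add: G.lcos_m_assoc G.lcos_mult_one)
  \<comment> \<open>Since 1 lies in \<open>U\<close>, the group component \<open>inv g\<close> of
    \<open>?t\<close> lies in its support, as the carrier demands.\<close>
  have "inv\<^bsub>G\<^esub> g \<otimes>\<^bsub>G\<^esub> \<one>\<^bsub>G\<^esub> \<in> ?V"
    using U(4) by (rule l_coset_memI)
  then have t: "?t \<in> carrier S"
    using ic car U by (simp add: translate_Omega_sigma finite_l_coset)
  show ?thesis
  proof (rule ex1I[of _ ?t], intro conjI)
    show "selem_mult K G \<sigma> (selem_mult K G \<sigma> s ?t) s = s"
      unfolding Elem selem_mult_mult_self_iff[OF mem t] using gV ic by (simp add: c_def)
    \<comment> \<open>The coefficient condition for \<open>tst = t\<close> involves the twist of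
      \<open>(inv g, g)\<close>, which the commutation lemma converts to the twist in
      \<open>c\<close>.\<close>
    have "\<sigma> (inv\<^bsub>G\<^esub> g) g \<otimes>\<^bsub>K\<^esub> inv\<^bsub>K\<^esub> c \<otimes>\<^bsub>K\<^esub> k = c \<otimes>\<^bsub>K\<^esub> inv\<^bsub>K\<^esub> c"
      using car ic unfolding twist_inv_commute[OF U(1,3)] c_def by (simp add: K.m_ac)
    then show "selem_mult K G \<sigma> (selem_mult K G \<sigma> ?t s) ?t = ?t"
      unfolding Elem selem_mult_mult_self_iff[OF t mem] using car ic by simp
  next
    fix t' assume t': "t' \<in> carrier S \<and> selem_mult K G \<sigma> (selem_mult K G \<sigma> s t') s = s \<and>
      selem_mult K G \<sigma> (selem_mult K G \<sigma> t' s) t' = t'"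
    then obtain r V h where eq: "t' = Elem r V h"
      using Elem by (cases t') auto
    have mem': "Elem r V h \<in> carrier S"
      using t' eq by simp
    have V: "V \<subseteq> carrier G" "r \<in> carrier K"
      using mem' Omega_sigma_subset by auto
    \<comment> \<open>The first equation fixes the group component and the scalar, and bounds the
      support \<open>V\<close> from above.\<close>
    have sts: "h = inv\<^bsub>G\<^esub> g" "g <#\<^bsub>G\<^esub> V \<subseteq> U" "c \<otimes>\<^bsub>K\<^esub> r = \<one>\<^bsub>K\<^esub>"
      using t' selem_mult_mult_self_iff[OF mem mem'] by (auto simp: Elem eq c_def)
    \<comment> \<open>The second equation, with the roles exchanged, bounds \<open>V\<close> from
      below.\<close>
    have "h <#\<^bsub>G\<^esub> U \<subseteq> V"
      using t' selem_mult_mult_self_iff[OF mem' mem] by (auto simp: Elem eq)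
    moreover have "inv\<^bsub>G\<^esub> g <#\<^bsub>G\<^esub> (g <#\<^bsub>G\<^esub> V) \<subseteq> ?V"
      using sts(2) by (auto simp: l_coset_def)
    moreover have "inv\<^bsub>G\<^esub> g <#\<^bsub>G\<^esub> (g <#\<^bsub>G\<^esub> V) = V"
      using car V by (simp add: G.lcos_m_assoc G.lcos_mult_one)
    ultimately have "V = ?V"
      using sts(1) by auto
    moreover have "r = inv\<^bsub>K\<^esub> c"
      using sts(3) ic(3) K.m_lcancel[OF c(2,1) V(2) ic(1)] by simp
    ultimately show "t' = ?t"
      using sts(1) eq by simp
  qed (rule t)
qed

lemma kappa_cancellative_inverse_monoid_S: "kappa_cancellative_inverse_monoid K S"
proof (intro kappa_cancellative_inverse_monoid.intro kappa_cancellative_semigroup_S)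
  show "inverse_monoid S"
  proof unfold_locales
    show "\<exists>!t. t \<in> carrier S \<and> s \<otimes>\<^bsub>S\<^esub> t \<otimes>\<^bsub>S\<^esub> s = s \<and> t \<otimes>\<^bsub>S\<^esub> s \<otimes>\<^bsub>S\<^esub> t = t"
      if "s \<in> carrier S" for s
      unfolding S_simps(1) using selem_inverse[OF that] .
  qed (auto intro: selem_mult_closed selem_mult_assoc selem_mult_one
      simp: singleton_one_Omega_sigma)
qed

end

section \<open>From factor sets to normalised twists\<close>

context nontrivial_unital_algebra
begin

text \<open>The scalar \<open>a - 1\<close> annihilates \<open>x\<close>; if it were nonzero,
  multiplying by its inverse would give \<open>x = 0\<close>.\<close>

lemma smult_eq_self_imp_one:
  assumes "a \<in> carrier K" "x \<in> carrier R" "x \<noteq> \<zero>\<^bsub>R\<^esub>" "a \<odot>\<^bsub>R\<^esub> x = x"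
  shows "a = \<one>\<^bsub>K\<^esub>"
proof (rule ccontr)
  assume "a \<noteq> \<one>\<^bsub>K\<^esub>"
  define b where "b = a \<ominus>\<^bsub>K\<^esub> \<one>\<^bsub>K\<^esub>"
  have b: "b \<in> carrier K" "b \<noteq> \<zero>\<^bsub>K\<^esub>"
    using assms(1) \<open>a \<noteq> \<one>\<^bsub>K\<^esub>\<close> K.minus_equality[of a "\<ominus>\<^bsub>K\<^esub> \<one>\<^bsub>K\<^esub>"]
    by (auto simp: b_def a_minus_def)
  then have ib: "inv\<^bsub>K\<^esub> b \<in> carrier K" "inv\<^bsub>K\<^esub> b \<otimes>\<^bsub>K\<^esub> b = \<one>\<^bsub>K\<^esub>"
    using K.field_Units by auto
  have "b \<odot>\<^bsub>R\<^esub> x = \<zero>\<^bsub>R\<^esub>"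
    using assms by (simp add: b_def a_minus_def smult_l_distr smult_l_minus r_neg)
  then have "inv\<^bsub>K\<^esub> b \<odot>\<^bsub>R\<^esub> (b \<odot>\<^bsub>R\<^esub> x) = \<zero>\<^bsub>R\<^esub>"
    using ib by simp
  then show False
    using assms b ib by (simp add: smult_assoc1[symmetric])
qed

end

text \<open>Putting the identity into the two multiplication laws shows that the twists of
  \<open>(g, 1)\<close> and \<open>(1, g)\<close> fix \<open>\<Gamma> g\<close> under scalar
  multiplication. A scalar fixing a nonzero element is 1.\<close>

lemma (in partial_projective_rep) normalised_twist: "normalised_twist K G \<sigma>"
proof unfold_locales
  show closed: "\<sigma> g h \<in> carrier K" if "g \<in> carrier G" "h \<in> carrier G" for g h
    using \<sigma>_closed that by auto
  have \<Gamma>: "\<Gamma> g \<in> carrier R" if "g \<in> carrier G" for g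
    using \<Gamma>_closed that by auto
  have right: "\<sigma> g \<one>\<^bsub>G\<^esub> \<odot>\<^bsub>R\<^esub> \<Gamma> g = \<Gamma> g" if "g \<in> carrier G" for g
    using \<Gamma>_mult_right[of g "\<one>\<^bsub>G\<^esub>"] that \<Gamma> by (simp add: \<Gamma>_one)
  have left: "\<sigma> \<one>\<^bsub>G\<^esub> g \<odot>\<^bsub>R\<^esub> \<Gamma> g = \<Gamma> g" if "g \<in> carrier G" for g
    using \<Gamma>_mult_left[of "\<one>\<^bsub>G\<^esub>" g] that \<Gamma> by (simp add: \<Gamma>_one)
  show "\<sigma> \<one>\<^bsub>G\<^esub> \<one>\<^bsub>G\<^esub> = \<one>\<^bsub>K\<^esub>"
    using right[of "\<one>\<^bsub>G\<^esub>"] closed one_neq_zero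
    by (intro smult_eq_self_imp_one[of _ "\<one>\<^bsub>R\<^esub>"]) (auto simp: \<Gamma>_one)
  show "\<sigma> g \<one>\<^bsub>G\<^esub> = \<one>\<^bsub>K\<^esub>" if g: "g \<in> carrier G" and nz: "\<sigma> g \<one>\<^bsub>G\<^esub> \<noteq> \<zero>\<^bsub>K\<^esub>" for g
  proof -
    \<comment> \<open>If \<open>\<Gamma> g\<close> vanished, so would
      \<open>\<Gamma> g \<otimes> \<Gamma> 1\<close>, and then the twist of \<open>(g, 1)\<close>
      would be zero.\<close>
    have "\<Gamma> g \<noteq> \<zero>\<^bsub>R\<^esub>"
      using \<Gamma>_mult_zero[of g "\<one>\<^bsub>G\<^esub>"] g nz by (auto simp: \<Gamma>_one)
    then show ?thesis
      using smult_eq_self_imp_one[OF _ _ _ right] closed \<Gamma> g by simp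
  qed
  show "\<sigma> \<one>\<^bsub>G\<^esub> g = \<one>\<^bsub>K\<^esub>" if g: "g \<in> carrier G" and nz: "\<sigma> \<one>\<^bsub>G\<^esub> g \<noteq> \<zero>\<^bsub>K\<^esub>" for g
  proof -
    have "\<Gamma> g \<noteq> \<zero>\<^bsub>R\<^esub>"
      using \<Gamma>_mult_zero[of "\<one>\<^bsub>G\<^esub>" g] g nz by (auto simp: \<Gamma>_one)
    then show ?thesis
      using smult_eq_self_imp_one[OF _ _ _ left] closed \<Gamma> g by simp
  qed
qed

theorem proposition5p2:
  fixes K :: "('k, 'm) ring_scheme" and G :: "('g, 'n) monoid_scheme"
    and \<sigma> :: "'g \<Rightarrow> 'g \<Rightarrow> 'k"
  assumes "field K" and "group G" and "\<sigma> \<in> pm TYPE('r) K G"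
  shows "kappa_cancellative_inverse_monoid K (S_sigma K G \<sigma>)"
proof -
  obtain R :: "('k, 'r) module" and \<Gamma> where "partial_projective_rep K G R \<sigma> \<Gamma>"
    using assms(3) unfolding pm_def by auto
  then have "normalised_twist K G \<sigma>"
    by (rule partial_projective_rep.normalised_twist)
  then show ?thesis
    by (rule normalised_twist.kappa_cancellative_inverse_monoid_S)
qed

end
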